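(* Let $p$ be an odd prime, $z\in\mathbb{F}_p$, and let $t\in\mathbb{F}$ be a root of $\overline\gamma_z(X)$. Then $(t^p-t)^{p-1}=t^{p^2}$. In particular $(t^p-t)^{p-1}$ is also a root of $\overline\gamma_z(X)$.
   Context: $\mathbb{F}$ is an algebraic closure of $\mathbb{F}_p$. For $z\in\mathbb{F}_p$, $\gamma_z(X):=X^{p+1}+(1+z)X^p+X+1\in\mathbb{F}_p[X]$, and $\overline\gamma_z(X):=1$ if $z=0$; $\overline\gamma_z(X):=\gamma_z(X)/(X-1)$ if $z=-4$; $\overline\gamma_z(X):=\gamma_z(X)/(X^2+(z+2)X+1)$ if $z\ne0,-4$ and $z^2+4z$ is a square in $\mathbb{F}_p$; $\overline\gamma_z(X):=\gamma_z(X)$ if $z^2+4z$ is a non-square in $\mathbb{F}_p$. (The quantity $(t^p-t)^{p-1}$ is the value at $(t,1)$ of Dickson's invariant $I_0=[1,2]/[0,1]$, where $[i,j]=x^{p^i}y^{p^j}-x^{p^j}y^{p^i}$.) *)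

theory Defs
  imports "HOL-Algebra.Algebraic_Closure_Type" "HOL-Library.Cardinality"
begin

(* The prime field F_p is rendered as an arbitrary field 'k with CARD('k) = p prime, and its
   algebraic closure as the type 'k alg_closure with canonical embedding to_ac. *)

definition gamma :: "nat \<Rightarrow> 'k::field \<Rightarrow> 'k poly" where
  "gamma p z = [:0, 1:] ^ (p + 1) + [:1 + z:] * [:0, 1:] ^ p + [:0, 1:] + 1"

(* The polynomial divisions are exact, see gamma_dvd_minus_4 and gamma_dvd_square below.
   is_square also holds for 0, but z^2 + 4 z = 0 only if z = 0 or z = -4, tested first. *)
definition gamma_bar :: "nat \<Rightarrow> 'k::field \<Rightarrow> 'k poly" where
  "gamma_bar p z =
     (if z = 0 then 1
      else if z = -4 then gamma p z div ([:0, 1:] - 1)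
      else if is_square (z^2 + 4 * z)
        then gamma p z div ([:0, 1:] ^ 2 + [:z + 2:] * [:0, 1:] + 1)
      else gamma p z)"

lemma gamma_dvd_minus_4: "([:0, 1:] - 1 :: 'k::field poly) dvd gamma p (-4)"
proof -
  have "([:0, 1:] - 1 :: 'k poly) = [:-1, 1:]"
    by (simp add: one_pCons)
  moreover have "poly (gamma p (-4)) (1::'k) = 0"
    by (simp add: gamma_def)
  ultimately show ?thesis
    by (simp add: poly_eq_0_iff_dvd)
qed

lemma gamma_dvd_square:
  fixes z :: "'k::finite_field"
  assumes p: "prime p" "odd p" "CARD('k) = p"
    and z: "z \<noteq> 0" "z \<noteq> -4" "is_square (z^2 + 4 * z)"
  shows "([:0, 1:] ^ 2 + [:z + 2:] * [:0, 1:] + 1) dvd gamma p z"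
proof -
  have fermat: "x ^ p = x" for x :: 'k
    using finite_field_power_card_eq_same[of x] p by simp
  have two: "(2::'k) \<noteq> 0"
  proof
    assume 2: "(2::'k) = 0"
    have "bij_betw (\<lambda>y::'k. y + 1) UNIV UNIV"
      by (rule bij_betw_byWitness[where f' = "\<lambda>y. y - 1"]) auto
    then have "(\<Sum>y\<in>UNIV. y + 1) = \<Sum>(UNIV::'k set)"
      by (rule sum.reindex_bij_betw[where g = "\<lambda>y. y"])
    then have "of_nat p = (0::'k)"
      using p by (simp add: sum.distrib)
    moreover obtain m where "p = 2 * m + 1"
      using p by (auto elim: oddE)
    ultimately show False
      using 2 by simp
  qed
  obtain w where w: "z^2 + 4 * z = w^2"
    using z by (auto simp: is_nth_power_def)
  have "z^2 + 4 * z = z * (z + 4)"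
    by (simp add: power2_eq_square algebra_simps)
  then have w0: "w \<noteq> 0"
    using z w by (auto simp: add_eq_0_iff2)
  define r s where "r = (- (z + 2) + w) / 2" and "s = (- (z + 2) - w) / 2"
  have r2: "2 * r = - (z + 2) + w" and s2: "2 * s = - (z + 2) - w"
    using two unfolding r_def s_def by (simp_all only: nonzero_mult_div_cancel_left times_divide_eq_right not_False_eq_True)
  have "2 * (r + s) = 2 * (- (z + 2))"
    unfolding distrib_left r2 s2 by (simp add: algebra_simps)
  then have rs: "r + s = - (z + 2)"
    using two mult_left_cancel by blast
  have 4: "(4::'k) = 2 * 2" by simp
  have "4 * (r * s) = (2 * r) * (2 * s)" by simp
  also have "\<dots> = (- (z + 2) + w) * (- (z + 2) - w)"
    by (simp only: r2 s2)
  also have "\<dots> = 4 + (z^2 + 4 * z - w^2)"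
    by (simp add: algebra_simps power2_eq_square)
  finally have "4 * (r * s) = 4 * 1"
    using w by simp
  then have rs': "r * s = 1"
    using two unfolding 4 by (metis mult_cancel_left no_zero_divisors)
  have "2 * (r - s) = 2 * w"
    unfolding right_diff_distrib r2 s2 by (simp add: algebra_simps)
  then have "r - s = w"
    using two mult_left_cancel by blast
  then have "r \<noteq> s"
    using w0 by auto
  have Q: "[:0, 1:] ^ 2 + [:z + 2:] * [:0, 1:] + 1 = [:-r, 1:] * [:-s, 1:]"
  proof -
    have z2: "z + 2 = - (r + s)"
      using rs by simp
    show ?thesis
      unfolding z2 using rs' by (simp add: power2_eq_square one_pCons mult.commute)
  qed
  define g where "g = gamma p z"
  have root: "poly g x = 0" if "x = r \<or> x = s" for x
  proof -
    have "poly g x = poly ([:-r, 1:] * [:-s, 1:]) x"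
      unfolding g_def gamma_def Q[symmetric]
      by (simp add: fermat power2_eq_square algebra_simps)
    then show ?thesis using that by auto
  qed
  obtain h where h: "g = [:-r, 1:] * h"
    using root[of r] by (auto simp: poly_eq_0_iff_dvd)
  have "poly h s = 0"
    using root[of s] \<open>r \<noteq> s\<close> h by auto
  then have "[:-s, 1:] dvd h"
    by (simp add: poly_eq_0_iff_dvd)
  then show ?thesis
    unfolding Q h g_def[symmetric] by (rule mult_dvd_mono[OF dvd_refl])
qed

end

(* A root t of gamma_bar satisfies t^p = M t for the Moebius map M x = - (x + 1) / (x + 1 + z) over
   F_p, hence t^(p^2) = M (M t) = -1 / (t + z + 2).  With s = t^p and u = t^(p^2) this yields
   u - s = (s - t) * u, and (s - t)^p = u - s by the Frobenius.  Cancelling s - t requires that t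
   does not lie in F_p.  On F_p, gamma agrees with X^2 + (z + 2) X + 1, so it has no root there if
   z^2 + 4 z is a non-square; otherwise a common root in F_p of gamma_bar and of the polynomial
   divided out would be a double root of gamma, whose derivative on F_p is X + 1 and vanishes only
   at -1, which is not a root. *)
theory Submission
  imports Defs "HOL-Number_Theory.Residues"
begin

lemma CHAR_eq_CARD:
  assumes "prime p" "CARD('k::finite_field) = p"
  shows "CHAR('k) = p"
  using CHAR_dvd_CARD[where 'a = 'k] assms CHAR_not_1[where 'a = 'k]
  by (auto simp: prime_nat_iff)

lemma map_poly_to_ac_add: "map_poly to_ac (q + r) = map_poly to_ac q + map_poly to_ac r"
  by (intro poly_eqI) (simp add: coeff_map_poly)

lemma map_poly_to_ac_mult: "map_poly to_ac (q * r) = map_poly to_ac q * map_poly to_ac r"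
  by (intro poly_eqI) (simp add: coeff_map_poly coeff_mult to_ac_sum)

lemma map_poly_to_ac_power: "map_poly to_ac (q ^ n) = map_poly to_ac q ^ n"
  by (induction n) (simp_all add: map_poly_to_ac_mult)

lemma poly_map_poly_to_ac: "poly (map_poly to_ac q) (to_ac a) = to_ac (poly q a)"
  by (induction q) (simp_all add: map_poly_pCons)

text \<open>The Frobenius map is additive and multiplicative and fixes the coefficients in F_p, so
  it commutes with evaluation. Hence it permutes the roots of a polynomial over F_p.\<close>

lemma poly_map_poly_to_ac_power:
  fixes q :: "'k::finite_field poly"
  assumes "prime p" "CARD('k) = p"
  shows "poly (map_poly to_ac q) (x ^ p) = poly (map_poly to_ac q) x ^ p"
proof -
  have char: "p = CHAR('k alg_closure)"
    using CHAR_eq_CARD[OF assms] by simp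
  have "to_ac c ^ p = to_ac c" for c :: 'k
    using finite_field_power_card_eq_same[of c] assms(2) by (simp flip: to_ac_power)
  moreover have "0 ^ p = (0 :: 'k alg_closure)"
    using assms(1) by (simp add: prime_gt_0_nat)
  moreover have "(x + y) ^ p = x ^ p + y ^ p" for x y :: "'k alg_closure"
    using assms(1) char by (intro freshmans_dream) auto
  ultimately show ?thesis
    by (induction q) (simp_all add: map_poly_pCons power_mult_distrib)
qed

text \<open>The polynomial X^n - X with n = \<open>CARD('k)\<close> has at most n roots, and the n
  embedded elements of the finite field already supply them all.\<close>

lemma range_to_ac_if_power_eq_self:
  fixes x :: "'k::finite_field alg_closure"
  assumes "x ^ CARD('k) = x"
  shows "x \<in> range to_ac"
proof -
  define n where "n = CARD('k)"
  \<comment> \<open>The bound n > 1 keeps the monomials X^n and X from cancelling, so that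
    \<open>f\<close> is nonzero.\<close>
  have "card {0, 1 :: 'k} \<le> n"
    unfolding n_def by (intro card_mono) auto
  then have n: "n > 1"
    by simp
  define f :: "'k alg_closure poly" where "f = monom 1 n - monom 1 1"
  have "coeff f n = 1"
    using n by (simp add: f_def)
  then have "f \<noteq> 0"
    by auto
  have "degree f \<le> n"
    unfolding f_def using n
    by (intro degree_diff_le) (auto simp: degree_monom_eq)
  have roots: "{y. poly f y = 0} = {y. y ^ n = y}"
    by (simp add: f_def poly_monom)
  have "range (to_ac :: 'k \<Rightarrow> _) \<subseteq> {y. poly f y = 0}"
    using finite_field_power_card_eq_same[where 'a = 'k]
    by (auto simp: roots n_def simp flip: to_ac_power)
  moreover have "card {y. poly f y = 0} \<le> card (range (to_ac :: 'k \<Rightarrow> _))"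
    using card_poly_roots_bound[OF \<open>f \<noteq> 0\<close>] \<open>degree f \<le> n\<close>
    by (simp add: card_image inj_to_ac n_def)
  ultimately have "range (to_ac :: 'k \<Rightarrow> _) = {y. poly f y = 0}"
    by (intro card_seteq poly_roots_finite \<open>f \<noteq> 0\<close>)
  then show ?thesis
    using assms by (simp add: roots n_def)
qed

lemma gamma_bar_dvd_gamma:
  fixes z :: "'k::finite_field"
  assumes "prime p" "odd p" "CARD('k) = p"
  shows "gamma_bar p z dvd gamma p z"
proof -
  have *: "g div d dvd g" if "d dvd g" for d g :: "'k poly"
    using that by (metis dvd_def dvd_div_mult_self mult.commute)
  show ?thesis
    unfolding gamma_bar_def
    using *[OF gamma_dvd_minus_4] *[OF gamma_dvd_square[OF assms]] by auto
qed

lemma poly_gamma_eq: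
  fixes z :: "'k::finite_field"
  assumes "CARD('k) = p"
  shows "poly (gamma p z) a = a^2 + (z + 2) * a + 1"
  using finite_field_power_card_eq_same[of a] assms
  by (simp add: gamma_def power2_eq_square algebra_simps)

text \<open>In characteristic p the formal derivative collapses to X^p + 1, and a^p = a on
  F_p.\<close>

lemma poly_pderiv_gamma:
  fixes z :: "'k::finite_field"
  assumes "prime p" "CARD('k) = p"
  shows "poly (pderiv (gamma p z)) a = a + 1"
proof -
  have "of_nat p = (0::'k)"
    using CHAR_eq_CARD[OF assms] by (metis of_nat_CHAR)
  moreover have "a ^ p = a"
    using finite_field_power_card_eq_same[of a] assms(2) by simp
  ultimately show ?thesis
    by (simp add: gamma_def pderiv_add pderiv_mult pderiv_smult pderiv_power pderiv_pCons one_pCons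
        del: power_Suc)
qed

lemma no_double_root_gamma:
  fixes z :: "'k::finite_field"
  assumes "prime p" "CARD('k) = p" "z \<noteq> 0"
    and "gamma p z = d * g" "poly d a = 0" "poly g a = 0"
  shows False
proof -
  have "poly (pderiv (gamma p z)) a = 0"
    using assms(4-6) by (simp add: pderiv_mult)
  then have "a = -1"
    using poly_pderiv_gamma[OF assms(1,2)] by (simp add: eq_neg_iff_add_eq_0)
  moreover have "poly (gamma p z) a = 0"
    using assms(4,5) by simp
  \<comment> \<open>At -1 the value of \<open>gamma p z\<close> is 1 - (z + 2) + 1 = -z.\<close>
  ultimately show False
    using \<open>z \<noteq> 0\<close> by (simp add: poly_gamma_eq[OF assms(2)])
qed

lemma poly_gamma_bar_nonzero:
  fixes z a :: "'k::finite_field"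
  assumes "prime p" "odd p" "CARD('k) = p"
  shows "poly (gamma_bar p z) a \<noteq> 0"
proof
  assume root: "poly (gamma_bar p z) a = 0"
  then have "poly (gamma p z) a = 0"
    using gamma_bar_dvd_gamma[OF assms, of z] by (auto elim!: dvdE)
  then have a: "a^2 + (z + 2) * a + 1 = 0"
    using poly_gamma_eq[OF assms(3)] by simp
  consider "z = 0" | "z \<noteq> 0" "z = -4" | "z \<noteq> 0" "z \<noteq> -4" "is_square (z^2 + 4 * z)"
    | "z \<noteq> 0" "z \<noteq> -4" "\<not> is_square (z^2 + 4 * z)"
    by blast
  then show False
  proof cases
    case 1
    then show False
      using root by (simp add: gamma_bar_def)
  next
    case 2
    \<comment> \<open>For z = -4 the quadratic X^2 + (z + 2) X + 1 is (X - 1)^2.\<close>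
    have "(a - 1)^2 = 0"
      using a 2(2) by (simp add: power2_eq_square algebra_simps)
    then have "poly ([:0, 1:] - 1) a = 0"
      by simp
    moreover have "gamma p z = ([:0, 1:] - 1) * gamma_bar p z"
      using 2 gamma_dvd_minus_4[of p, where 'k = 'k] by (simp add: gamma_bar_def)
    ultimately show False
      using no_double_root_gamma[OF assms(1,3) 2(1)] root by blast
  next
    case 3
    have "poly ([:0, 1:] ^ 2 + [:z + 2:] * [:0, 1:] + 1) a = 0"
      using a by (simp add: power2_eq_square algebra_simps)
    moreover have "gamma p z = ([:0, 1:] ^ 2 + [:z + 2:] * [:0, 1:] + 1) * gamma_bar p z"
      using 3 dvd_mult_div_cancel[OF gamma_dvd_square[OF assms 3]]
      unfolding gamma_bar_def by presburger
    ultimately show False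
      using no_double_root_gamma[OF assms(1,3) 3(1)] root by blast
  next
    case 4
    \<comment> \<open>Completing the square: z^2 + 4 z is the discriminant of the quadratic, so a
      root in F_p would make it a square.\<close>
    have "z^2 + 4 * z = (2 * a + z + 2)^2 - 4 * (a^2 + (z + 2) * a + 1)"
      by (simp add: power2_eq_square algebra_simps)
    then have "z^2 + 4 * z = (2 * a + z + 2)^2"
      using a by simp
    then show False
      using 4 by auto
  qed
qed

lemma moebius_iterate_relation:
  fixes t s u z :: "'a::field"
  assumes "s * t + (1 + z) * s + t + 1 = 0" "u * s + (1 + z) * u + s + 1 = 0" "z \<noteq> 0"
  shows "u - s = (s - t) * u"
proof -
  \<comment> \<open>The multipliers are chosen to eliminate \<open>s\<close>. The factor z appears
    because the square of the matrix (-1, -1; 1, 1 + z) of M is z times (0, -1; 1, z + 2).\<close>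
  have "z * (u * (t + 2 + z) + 1) =
      (t + 1 + z) * (u * s + (1 + z) * u + s + 1) - (u + 1) * (s * t + (1 + z) * s + t + 1)"
    by (simp add: algebra_simps)
  then have "u * (t + 2 + z) + 1 = 0"
    using assms by simp
  moreover have "u - s - (s - t) * u =
      (u * (t + 2 + z) + 1) - (u * s + (1 + z) * u + s + 1)"
    by (simp add: algebra_simps)
  ultimately show ?thesis
    using assms(2) by simp
qed

theorem theorem9p2:
  fixes p :: nat and z :: "'k::finite_field" and t :: "'k alg_closure"
  assumes "prime p" and "odd p" and "CARD('k) = p"
    and "poly (map_poly to_ac (gamma_bar p z)) t = 0"
  shows "(t ^ p - t) ^ (p - 1) = t ^ (p ^ 2) \<and>
         poly (map_poly to_ac (gamma_bar p z)) ((t ^ p - t) ^ (p - 1)) = 0"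
proof -
  define s u where "s = t ^ p" and "u = s ^ p"
  have "p > 0"
    using assms(1) by (simp add: prime_gt_0_nat)
  have u: "t ^ (p ^ 2) = u"
    by (simp add: u_def s_def power2_eq_square power_mult)
  have frob_root: "poly (map_poly to_ac q) (x ^ p) = 0"
    if "poly (map_poly to_ac q) x = 0" for q :: "'k poly" and x
    using that \<open>p > 0\<close> by (simp add: poly_map_poly_to_ac_power[OF assms(1,3)])
  have z: "z \<noteq> 0"
    using assms(4) by (auto simp: gamma_bar_def)
  have "t \<notin> range to_ac"
    using assms(4) poly_gamma_bar_nonzero[OF assms(1-3)] by (auto simp: poly_map_poly_to_ac)
  then have "s \<noteq> t"
    using range_to_ac_if_power_eq_self[of t] assms(3) by (auto simp: s_def)
  have gamma_t: "poly (map_poly to_ac (gamma p z)) t = 0"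
    using gamma_bar_dvd_gamma[OF assms(1-3), of z] assms(4)
    by (auto simp: map_poly_to_ac_mult elim!: dvdE)
  have poly_gamma: "poly (map_poly to_ac (gamma p z)) x = x ^ p * x + (1 + to_ac z) * x ^ p + x + 1"
    for x
    by (simp add: gamma_def map_poly_to_ac_add map_poly_to_ac_mult map_poly_to_ac_power
        map_poly_pCons map_poly_smult algebra_simps)
  \<comment> \<open>The second equation is the first one at \<open>s\<close>, which is a root of
    gamma because it is the Frobenius image of \<open>t\<close>.\<close>
  have "s * t + (1 + to_ac z) * s + t + 1 = 0" "u * s + (1 + to_ac z) * u + s + 1 = 0"
    using gamma_t frob_root[OF gamma_t] by (simp_all only: poly_gamma s_def u_def)
  then have "u - s = (s - t) * u"
    by (rule moebius_iterate_relation) (use z in simp)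
  moreover have "(s - t) ^ p = u - s"
  proof -
    \<comment> \<open>Additivity of Frobenius applied to s = (s - t) + t gives its compatibility
      with the difference.\<close>
    have "(s - t + t) ^ p = (s - t) ^ p + t ^ p"
      using CHAR_eq_CARD[OF assms(1,3)] assms(1) by (intro freshmans_dream) auto
    then show ?thesis
      by (simp add: u_def s_def)
  qed
  ultimately have "(s - t) * (s - t) ^ (p - 1) = (s - t) * u"
    using \<open>p > 0\<close> by (simp add: power_eq_if)
  then have "(t ^ p - t) ^ (p - 1) = u"
    using \<open>s \<noteq> t\<close> by (simp add: s_def)
  \<comment> \<open>Two applications of Frobenius carry the root \<open>t\<close> to
    \<open>u\<close>.\<close>
  moreover have "poly (map_poly to_ac (gamma_bar p z)) u = 0"
    unfolding u_def s_def using assms(4) by (intro frob_root)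
  ultimately show ?thesis
    using u by simp
qed

end
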